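(* Let $T$ be a rooted tree. Then there is an isomorphism of posets $\mathrm{X}(\mathbf{A}^T)\cong\mathbb{P}(T)^\partial$, where $\mathrm{X}(\mathbf{A}^T)$ is the set of prime ideals of the commutative BCK-algebra $\mathbf{A}^T$ ordered by inclusion, and $\mathbb{P}(T)^\partial$ is the order-dual of the poset $\mathbb{P}(T)$ of root-based paths in $T$, ordered by $p\subseteq q$ iff $p$ is a prefix of $q$.
   Context: A commutative BCK-algebra is an algebra $\mathbf{A}=\langle A;\cdot,0\rangle$ of type $(2,0)$ such that for all $x,y,z\in A$: $(x\cdot y)\cdot z=(x\cdot z)\cdot y$; $x\cdot(x\cdot y)=y\cdot(y\cdot x)$; $x\cdot x=0$; $x\cdot 0=x$. Put $x\wedge y:=y\cdot(y\cdot x)$. An ideal is a subset $I\subseteq A$ with $0\in I$ such that $x\cdot y\in I$ and $y\in I$ imply $x\in I$. An ideal $P$ is prime if $P\neq A$ and $x\wedge y\in P$ implies $x\in P$ or $y\in P$. Let $T$ be a (possibly infinite) rooted tree with root $\lambda$ and vertex set $V(T)$. A root-based path is a finite or infinite path in $T$ starting at $\lambda$ and moving away from the root (it contains at least $\lambda$); $[\lambda,\alpha]$ is the path from $\lambda$ to $\alpha$. For $\mathbf{u}\colon V(T)\to\mathbb{Z}$ write $u_\alpha$ for its value at $\alpha$ and $\mathbf{u}_p$ for the tuple of values of $\mathbf{u}$ along the path $p$; $\mathbf{0}$ is the zero function. The set $A^T$ consists of all $\mathbf{u}\colon V(T)\to\mathbb{Z}$ with finitely many non-zero values such that along every root-based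 path the first non-zero value (if any) is positive. With $\le_\ell$ the lexicographic order on tuples, define $$(\mathbf{u}\cdot\mathbf{v})_\alpha=\begin{cases}u_\alpha-v_\alpha&\text{if }\mathbf{u}_{[\lambda,\alpha]}>_\ell\mathbf{v}_{[\lambda,\alpha]},\\0&\text{if }\mathbf{u}_{[\lambda,\alpha]}\le_\ell\mathbf{v}_{[\lambda,\alpha]}.\end{cases}$$ Then $\mathbf{A}^T=\langle A^T;\cdot,\mathbf{0}\rangle$ is a commutative BCK-algebra. *)

theory Defs
  imports Main
begin

section \<open>Commutative BCK-algebras and their prime ideals\<close>

record 'a bck =
  bck_carrier :: "'a set"
  bck_diff :: "'a \<Rightarrow> 'a \<Rightarrow> 'a"
  bck_zero :: 'a

definition bck_meet :: "'a bck \<Rightarrow> 'a \<Rightarrow> 'a \<Rightarrow> 'a" where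
  "bck_meet A x y = bck_diff A y (bck_diff A y x)"

definition bck_ideal :: "'a bck \<Rightarrow> 'a set \<Rightarrow> bool" where
  "bck_ideal A I \<longleftrightarrow>
     I \<subseteq> bck_carrier A \<and> bck_zero A \<in> I \<and>
     (\<forall>x\<in>bck_carrier A. \<forall>y\<in>bck_carrier A. bck_diff A x y \<in> I \<and> y \<in> I \<longrightarrow> x \<in> I)"

definition bck_prime_ideal :: "'a bck \<Rightarrow> 'a set \<Rightarrow> bool" where
  "bck_prime_ideal A P \<longleftrightarrow>
     bck_ideal A P \<and> P \<noteq> bck_carrier A \<and>
     (\<forall>x\<in>bck_carrier A. \<forall>y\<in>bck_carrier A. bck_meet A x y \<in> P \<longrightarrow> x \<in> P \<or> y \<in> P)"

definition bck_spectrum :: "'a bck \<Rightarrow> 'a set set" where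
  "bck_spectrum A = {P. bck_prime_ideal A P}"


section \<open>Rooted trees\<close>

record 'v rooted_graph =
  verts :: "'v set"
  edges :: "'v set set"
  root :: 'v

definition walk :: "'v rooted_graph \<Rightarrow> 'v list \<Rightarrow> bool" where
  "walk T xs \<longleftrightarrow>
     xs \<noteq> [] \<and> set xs \<subseteq> verts T \<and> successively (\<lambda>x y. {x, y} \<in> edges T) xs"

text \<open>A cycle is listed without repeating its initial vertex at the end.\<close>

definition cycle :: "'v rooted_graph \<Rightarrow> 'v list \<Rightarrow> bool" where
  "cycle T xs \<longleftrightarrow>
     walk T xs \<and> distinct xs \<and> 3 \<le> length xs \<and> {last xs, hd xs} \<in> edges T"

text \<open>A rooted tree is a connected acyclic simple graph with a distinguished vertex. The vertex
  set is arbitrary, so infinite trees and vertices of infinite degree are included.\<close>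

definition rooted_tree :: "'v rooted_graph \<Rightarrow> bool" where
  "rooted_tree T \<longleftrightarrow>
     root T \<in> verts T \<and>
     edges T \<subseteq> {{x, y} | x y. x \<in> verts T \<and> y \<in> verts T \<and> x \<noteq> y} \<and>
     (\<forall>x\<in>verts T. \<forall>y\<in>verts T. \<exists>xs. walk T xs \<and> hd xs = x \<and> last xs = y) \<and>
     (\<nexists>xs. cycle T xs)"

text \<open>Distance from the root.\<close>

definition depth :: "'v rooted_graph \<Rightarrow> 'v \<Rightarrow> nat" where
  "depth T x = (LEAST n. \<exists>xs. walk T xs \<and> hd xs = root T \<and> last xs = x \<and> length xs = Suc n)"

definition away_step :: "'v rooted_graph \<Rightarrow> 'v \<Rightarrow> 'v \<Rightarrow> bool" where
  "away_step T x y \<longleftrightarrow> {x, y} \<in> edges T \<and> depth T x < depth T y"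


section \<open>Root-based paths\<close>

datatype 'v path = Fin "'v list" | Inf "nat \<Rightarrow> 'v"

primrec path_dom :: "'v path \<Rightarrow> nat set" where
  "path_dom (Fin xs) = {..<length xs}"
| "path_dom (Inf f) = UNIV"

primrec path_nth :: "'v path \<Rightarrow> nat \<Rightarrow> 'v" where
  "path_nth (Fin xs) = (\<lambda>i. xs ! i)"
| "path_nth (Inf f) = f"

definition root_path :: "'v rooted_graph \<Rightarrow> 'v path \<Rightarrow> bool" where
  "root_path T p \<longleftrightarrow>
     0 \<in> path_dom p \<and> path_nth p 0 = root T \<and>
     (\<forall>i. Suc i \<in> path_dom p \<longrightarrow> away_step T (path_nth p i) (path_nth p (Suc i)))"

definition root_paths :: "'v rooted_graph \<Rightarrow> 'v path set" where
  "root_paths T = {p. root_path T p}"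

definition path_prefix :: "'v path \<Rightarrow> 'v path \<Rightarrow> bool" where
  "path_prefix p q \<longleftrightarrow>
     path_dom p \<subseteq> path_dom q \<and> (\<forall>i\<in>path_dom p. path_nth p i = path_nth q i)"

text \<open>The path from the root to a vertex; it is unique in a rooted tree.\<close>

definition path_to :: "'v rooted_graph \<Rightarrow> 'v \<Rightarrow> 'v list" where
  "path_to T x = (THE xs. root_path T (Fin xs) \<and> last xs = x)"


section \<open>The algebra of a rooted tree\<close>

text \<open>An integer-valued function on the vertex set is represented by its extension by zero to
  the whole type.\<close>

definition tree_carrier :: "'v rooted_graph \<Rightarrow> ('v \<Rightarrow> int) set" where
  "tree_carrier T = {u.
     (\<forall>x. x \<notin> verts T \<longrightarrow> u x = 0) \<and>
     finite {x. u x \<noteq> 0} \<and>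
     (\<forall>p\<in>root_paths T. \<forall>i\<in>path_dom p.
        u (path_nth p i) \<noteq> 0 \<and> (\<forall>j<i. u (path_nth p j) = 0) \<longrightarrow> u (path_nth p i) > 0)}"

text \<open>\<^const>\<open>ord_class.lexordp\<close> is the strict lexicographic order; here it only compares lists
  of equal length, so the else-branch is the reverse non-strict comparison.\<close>

definition tree_diff :: "'v rooted_graph \<Rightarrow> ('v \<Rightarrow> int) \<Rightarrow> ('v \<Rightarrow> int) \<Rightarrow> 'v \<Rightarrow> int" where
  "tree_diff T u v = (\<lambda>x.
     if x \<in> verts T \<and> ord_class.lexordp (map v (path_to T x)) (map u (path_to T x))
     then u x - v x else 0)"

definition tree_algebra :: "'v rooted_graph \<Rightarrow> ('v \<Rightarrow> int) bck" where
  "tree_algebra T =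
     \<lparr>bck_carrier = tree_carrier T, bck_diff = tree_diff T, bck_zero = (\<lambda>_. 0)\<rparr>"


section \<open>Isomorphism of posets\<close>

definition posets_isomorphic :: "'a set \<Rightarrow> 'a rel \<Rightarrow> 'b set \<Rightarrow> 'b rel \<Rightarrow> bool" where
  "posets_isomorphic A r B s \<longleftrightarrow>
     partial_order_on A r \<and> partial_order_on B s \<and>
     (\<exists>f. bij_betw f A B \<and> (\<forall>x\<in>A. \<forall>y\<in>A. (x, y) \<in> r \<longleftrightarrow> (f x, f y) \<in> s))"

end

theory Submission
  imports Defs
begin

text \<open>The isomorphism sends a root-based path p to the set of all elements of the algebra that
  vanish at every vertex of p. A longer path imposes more conditions, so the order is reversed.

  The lexicographic comparison of two elements at a vertex depends only on the first vertex on
  the way from the root at which they differ. Hence, once the tree is replaced by the ancestor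
  order on its vertices, the algebra can be studied without lists of vertices: the lemmas
  \<open>tree_diff_eq\<close> and \<open>tree_carrier_iff\<close> make this translation. Acyclicity is needed exactly once,
  to see that a vertex has only one parent (\<open>parent_unique\<close>); it follows that the ancestors of a
  vertex form a finite chain. Root-based paths correspond to branches, the non-empty chains of
  vertices that contain all ancestors of their members (\<open>path_verts_branch\<close>,
  \<open>branch_obtain_path\<close>).

  That the elements vanishing on a branch form a prime ideal is a computation at the first
  vertices of the branch where the elements involved are non-zero (\<open>vanishing_prime\<close>).

  For the converse, let P be a prime ideal and F the set of vertices whose indicator function is
  not in P. If b is a proper ancestor of a, the indicator of a minus that of b is zero, so F
  contains all ancestors of its members. If a and b are incomparable, the meet of their indicators
  is zero, so by primality F is a chain. It remains to see that an ideal is determined by the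
  indicators it contains. On the one hand, an element whose support consists of vertices with
  indicator in the ideal can be reduced to zero by subtracting multiples of these indicators
  (\<open>ideal_if_support_in_ideal\<close>). On the other hand, if an element of the ideal has its first
  non-zero value on a path at a, then the indicator of a belongs to the ideal
  (\<open>ideal_single_first_nonzero\<close>). Thus P consists of the elements that vanish on F, and F is not
  empty because P is proper.\<close>

section \<open>Rooted trees as ordered sets\<close>

locale tree =
  fixes T :: "'v rooted_graph"
  assumes rooted_tree: "rooted_tree T"
begin

lemma root_in_verts: "root T \<in> verts T"
  using rooted_tree by (simp add: rooted_tree_def)

lemma edge_verts:
  assumes "{x, y} \<in> edges T"
  shows "x \<in> verts T" "y \<in> verts T"
proof -
  obtain a b where "{x, y} = {a, b}" "a \<in> verts T" "b \<in> verts T"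
    using assms rooted_tree unfolding rooted_tree_def by blast
  then show "x \<in> verts T" "y \<in> verts T"
    by (auto simp: doubleton_eq_iff)
qed

lemma acyclic: "\<not> cycle T xs"
  using rooted_tree by (simp add: rooted_tree_def)

lemma depth_le:
  assumes "walk T xs" "hd xs = root T"
  shows "depth T (last xs) \<le> length xs - 1"
proof -
  have "length xs = Suc (length xs - 1)"
    using assms by (cases xs) (auto simp: walk_def)
  then show ?thesis
    unfolding depth_def using assms by (intro Least_le) blast
qed

lemma obtain_shortest_walk:
  assumes "x \<in> verts T"
  obtains xs where "walk T xs" "hd xs = root T" "last xs = x" "length xs = Suc (depth T x)"
proof -
  obtain xs where xs: "walk T xs" "hd xs = root T" "last xs = x"
    using rooted_tree assms unfolding rooted_tree_def by blast
  have "length xs = Suc (length xs - 1)"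
    using xs by (cases xs) (auto simp: walk_def)
  with xs have "\<exists>n xs. walk T xs \<and> hd xs = root T \<and> last xs = x \<and> length xs = Suc n"
    by blast
  from LeastI_ex[OF this] show ?thesis
    unfolding depth_def[symmetric] using that by blast
qed

lemma depth_root [simp]: "depth T (root T) = 0"
  using depth_le[of "[root T]"] by (simp add: walk_def root_in_verts)

lemma depth_eq_0:
  assumes "x \<in> verts T" "depth T x = 0"
  shows "x = root T"
proof -
  obtain xs where "walk T xs" "hd xs = root T" "last xs = x" "length xs = Suc (depth T x)"
    using obtain_shortest_walk[OF assms(1)] .
  with assms(2) show ?thesis by (cases xs) auto
qed

lemma depth_edge:
  assumes "{x, y} \<in> edges T"
  shows "depth T y \<le> Suc (depth T x)"
proof -
  note v = edge_verts[OF assms]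
  obtain xs where xs: "walk T xs" "hd xs = root T" "last xs = x" "length xs = Suc (depth T x)"
    using obtain_shortest_walk[OF v(1)] .
  have "walk T (xs @ [y])"
    using xs assms v by (auto simp: walk_def successively_append_iff)
  moreover have "hd (xs @ [y]) = root T"
    using xs by (auto simp: walk_def)
  ultimately show ?thesis
    using depth_le[of "xs @ [y]"] xs by simp
qed

lemma depth_away_step:
  assumes "away_step T x y"
  shows "depth T y = Suc (depth T x)"
  using assms depth_edge[of x y] by (auto simp: away_step_def)

lemma obtain_parent:
  assumes "x \<in> verts T" "depth T x = Suc n"
  obtains y where "away_step T y x" "depth T y = n" "y \<in> verts T"
proof -
  obtain xs where xs: "walk T xs" "hd xs = root T" "last xs = x" "length xs = Suc (depth T x)"
    using obtain_shortest_walk[OF assms(1)] .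
  obtain ys where ys: "xs = ys @ [x]" "ys \<noteq> []"
  proof
    show "xs = butlast xs @ [x]"
      using xs by (metis append_butlast_last_id list.size(3) nat.distinct(1))
    show "butlast xs \<noteq> []"
      using xs(4) assms(2) by (metis Zero_not_Suc diff_Suc_1 length_butlast list.size(3))
  qed
  have w: "walk T ys" "hd ys = root T" "{last ys, x} \<in> edges T"
    using xs ys by (auto simp: walk_def successively_append_iff)
  have "depth T (last ys) \<le> n"
    using depth_le[OF w(1,2)] xs ys assms by simp
  moreover have "Suc n \<le> Suc (depth T (last ys))"
    using depth_edge[OF w(3)] assms by simp
  ultimately have "depth T (last ys) = n" by simp
  moreover from this have "away_step T (last ys) x"
    using w(3) assms(2) by (simp add: away_step_def)
  ultimately show ?thesis
    using that edge_verts[OF w(3)] by blast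
qed

text \<open>Climbing from both vertices towards the root until the two climbs meet gives a walk that
  never visits a level deeper than that of its ends; joining its ends to a common deeper
  neighbour would close a cycle.\<close>

lemma walk_between_same_depth:
  assumes "x \<in> verts T" "y \<in> verts T" "depth T x = n" "depth T y = n" "x \<noteq> y"
  shows "\<exists>xs. walk T xs \<and> distinct xs \<and> hd xs = x \<and> last xs = y \<and> 2 \<le> length xs \<and>
           (\<forall>z\<in>set xs. depth T z \<le> n)"
  using assms
proof (induction n arbitrary: x y)
  case 0
  then show ?case using depth_eq_0 by metis
next
  case (Suc n)
  obtain a where a: "away_step T a x" "depth T a = n" "a \<in> verts T"
    using obtain_parent[OF Suc.prems(1,3)] .
  obtain b where b: "away_step T b y" "depth T b = n" "b \<in> verts T"
    using obtain_parent[OF Suc.prems(2,4)] .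
  have e: "{x, a} \<in> edges T" "{b, y} \<in> edges T"
    using a b by (auto simp: away_step_def insert_commute)
  show ?case
  proof (cases "a = b")
    case True
    then have "walk T [x, a, y]" "distinct [x, a, y]"
      using e Suc.prems a b by (auto simp: walk_def)
    with Suc.prems a show ?thesis
      by (intro exI[of _ "[x, a, y]"]) auto
  next
    case False
    then obtain zs where zs: "walk T zs" "distinct zs" "hd zs = a" "last zs = b"
        "\<forall>z\<in>set zs. depth T z \<le> n"
      using Suc.IH[OF a(3) b(3) a(2) b(2)] by blast
    have ne: "zs \<noteq> []" using zs by (auto simp: walk_def)
    have "walk T (x # zs @ [y])"
      using zs e Suc.prems ne by (auto simp: walk_def successively_append_iff successively_Cons)
    moreover have "x \<notin> set zs" "y \<notin> set zs"
      using zs(5) Suc.prems by auto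
    ultimately show ?thesis
      using zs Suc.prems ne by (intro exI[of _ "x # zs @ [y]"]) (auto simp: Suc_leI)
  qed
qed

lemma parent_unique:
  assumes "away_step T x z" "away_step T y z"
  shows "x = y"
proof (rule ccontr)
  assume ne: "x \<noteq> y"
  have e: "{x, z} \<in> edges T" "{y, z} \<in> edges T"
    using assms by (auto simp: away_step_def)
  note v = edge_verts[OF e(1)] edge_verts[OF e(2)]
  have d: "depth T x = depth T y"
    using assms[THEN depth_away_step] by simp
  obtain xs where xs: "walk T xs" "distinct xs" "hd xs = x" "last xs = y" "2 \<le> length xs"
      "\<forall>w\<in>set xs. depth T w \<le> depth T y"
    using walk_between_same_depth[OF v(1,3) d refl ne] by blast
  have "walk T (z # xs)"
    using xs e v by (auto simp: walk_def successively_Cons insert_commute)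
  moreover have "z \<notin> set xs"
    using xs(6) depth_away_step[OF assms(2)] by auto
  ultimately have "cycle T (z # xs)"
    using xs e by (auto simp: cycle_def walk_def)
  then show False using acyclic by blast
qed

lemma root_path_vertex:
  assumes "root_path T p" "i \<in> path_dom p"
  shows "path_nth p i \<in> verts T" "depth T (path_nth p i) = i"
proof -
  have "path_nth p i \<in> verts T \<and> depth T (path_nth p i) = i"
    using assms(2)
  proof (induction i)
    case 0
    then show ?case using assms(1) root_in_verts by (simp add: root_path_def)
  next
    case (Suc i)
    have "i \<in> path_dom p"
      using Suc.prems by (cases p) auto
    moreover have step: "away_step T (path_nth p i) (path_nth p (Suc i))"
      using Suc.prems assms(1) by (simp add: root_path_def)
    then have "{path_nth p i, path_nth p (Suc i)} \<in> edges T"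
      by (simp add: away_step_def)
    ultimately show ?case
      using Suc.IH depth_away_step[OF step] edge_verts(2) by simp
  qed
  then show "path_nth p i \<in> verts T" "depth T (path_nth p i) = i" by auto
qed

lemma path_dom_downward:
  assumes "j \<in> path_dom p" "i \<le> j"
  shows "i \<in> path_dom p"
  using assms by (cases p) auto

lemma root_paths_agree:
  assumes "root_path T p" "root_path T q" "j \<in> path_dom p" "j \<in> path_dom q"
    "path_nth p j = path_nth q j" "i \<le> j"
  shows "path_nth p i = path_nth q i"
  using assms(6)
proof (induction i rule: inc_induct)
  case base
  then show ?case using assms by simp
next
  case (step n)
  have "Suc n \<in> path_dom p" "Suc n \<in> path_dom q"
    using assms step path_dom_downward by (metis Suc_leI)+
  with assms(1,2) step.IH have "away_step T (path_nth p n) (path_nth p (Suc n))"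
    "away_step T (path_nth q n) (path_nth p (Suc n))"
    by (auto simp: root_path_def)
  then show ?case using parent_unique by blast
qed

lemma obtain_root_path:
  assumes "x \<in> verts T"
  obtains xs where "root_path T (Fin xs)" "last xs = x"
proof -
  have "\<exists>xs. root_path T (Fin xs) \<and> last xs = x"
    using assms
  proof (induction "depth T x" arbitrary: x)
    case 0
    then have "x = root T" using depth_eq_0 by simp
    then show ?case by (intro exI[of _ "[root T]"]) (auto simp: root_path_def)
  next
    case (Suc n)
    obtain y where y: "away_step T y x" "depth T y = n" "y \<in> verts T"
      using obtain_parent[OF Suc.prems Suc.hyps(2)[symmetric]] .
    obtain ys where ys: "root_path T (Fin ys)" "last ys = y"
      using Suc.hyps(1) y by blast
    then have "ys \<noteq> []" by (auto simp: root_path_def)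
    then have "ys ! i = y" if "Suc i = length ys" for i
      using ys that last_conv_nth[of ys] by (metis diff_Suc_1)
    then have "root_path T (Fin (ys @ [x]))"
      using \<open>ys \<noteq> []\<close> ys(1) y(1) unfolding root_path_def
      by (auto simp: nth_append less_Suc_eq)
    then show ?case by auto
  qed
  with that show ?thesis by blast
qed

text \<open>Depth along a root-based path increases by one at each step, so two root-based paths reach
  a common vertex at the same index, and by uniqueness of parents they agree up to it.\<close>

lemma path_to_path_nth:
  assumes "root_path T p" "j \<in> path_dom p"
  shows "path_to T (path_nth p j) = map (path_nth p) [0..<Suc j]"
  unfolding path_to_def
proof (rule the_equality, intro conjI)
  show "root_path T (Fin (map (path_nth p) [0..<Suc j]))"
    unfolding root_path_def
  proof (intro conjI allI impI)
    show "0 \<in> path_dom (Fin (map (path_nth p) [0..<Suc j]))" by simp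
    show "path_nth (Fin (map (path_nth p) [0..<Suc j])) 0 = root T"
      using assms by (simp add: root_path_def nth_append)
  next
    fix i
    assume i: "Suc i \<in> path_dom (Fin (map (path_nth p) [0..<Suc j]))"
    then have "Suc i \<le> j" by simp
    then have "Suc i \<in> path_dom p" using assms(2) path_dom_downward by blast
    then show "away_step T (path_nth (Fin (map (path_nth p) [0..<Suc j])) i)
        (path_nth (Fin (map (path_nth p) [0..<Suc j])) (Suc i))"
      using assms(1) i by (simp add: root_path_def del: upt_Suc)
  qed
  show "last (map (path_nth p) [0..<Suc j]) = path_nth p j" by simp
next
  fix xs
  assume xs: "root_path T (Fin xs) \<and> last xs = path_nth p j"
  then have ne: "xs \<noteq> []" by (auto simp: root_path_def)
  then have last: "path_nth (Fin xs) (length xs - 1) = path_nth p j"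
    using xs by (simp add: last_conv_nth)
  have "length xs - 1 \<in> path_dom (Fin xs)"
    using ne by simp
  from root_path_vertex(2)[OF _ this] root_path_vertex(2)[OF assms] xs last
  have len: "length xs - 1 = j" by simp
  then have "j < length xs" using ne by (cases xs) auto
  show "xs = map (path_nth p) [0..<Suc j]"
  proof (rule nth_equalityI)
    show "length xs = length (map (path_nth p) [0..<Suc j])"
      using len ne by (cases xs) auto
    fix i
    assume "i < length xs"
    then have "i \<le> j" using len by simp
    then have "path_nth (Fin xs) i = path_nth p i"
      using root_paths_agree[of "Fin xs" p j i] xs assms last len \<open>j < length xs\<close> by simp
    with \<open>i \<le> j\<close> show "xs ! i = map (path_nth p) [0..<Suc j] ! i"
      by (simp del: upt_Suc)
  qed
qed

definition ancestor :: "'v \<Rightarrow> 'v \<Rightarrow> bool" (infix "\<preceq>" 50) where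
  "y \<preceq> x \<longleftrightarrow> x \<in> verts T \<and> y \<in> set (path_to T x)"

abbreviation proper_ancestor :: "'v \<Rightarrow> 'v \<Rightarrow> bool" (infix "\<prec>" 50) where
  "y \<prec> x \<equiv> y \<preceq> x \<and> y \<noteq> x"

lemma ancestor_path_nth:
  assumes "root_path T p" "j \<in> path_dom p"
  shows "y \<preceq> path_nth p j \<longleftrightarrow> (\<exists>i\<le>j. y = path_nth p i)"
proof -
  have "set (path_to T (path_nth p j)) = path_nth p ` {..j}"
    by (simp add: path_to_path_nth[OF assms] atLeast0LessThan lessThan_Suc_atMost del: upt_Suc)
  then show ?thesis
    using root_path_vertex(1)[OF assms] by (auto simp: ancestor_def)
qed

lemma proper_ancestor_path_nth:
  assumes "root_path T p" "j \<in> path_dom p"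
  shows "y \<prec> path_nth p j \<longleftrightarrow> (\<exists>i<j. y = path_nth p i)"
proof -
  have "path_nth p i \<noteq> path_nth p j" if "i < j" for i
    using that root_path_vertex(2)[OF assms(1), of i] root_path_vertex(2)[OF assms]
      path_dom_downward[OF assms(2), of i] by auto
  then show ?thesis
    unfolding ancestor_path_nth[OF assms] by (auto simp: le_less)
qed

lemma obtain_path_to:
  assumes "x \<in> verts T"
  obtains p where "root_path T p" "depth T x \<in> path_dom p" "path_nth p (depth T x) = x"
proof -
  obtain xs where xs: "root_path T (Fin xs)" "last xs = x"
    using obtain_root_path[OF assms] .
  then have ne: "xs \<noteq> []" by (auto simp: root_path_def)
  have dom: "length xs - 1 \<in> path_dom (Fin xs)" using ne by simp
  have x: "path_nth (Fin xs) (length xs - 1) = x"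
    using xs ne by (simp add: last_conv_nth)
  have d: "length xs - 1 = depth T x"
    using root_path_vertex(2)[OF xs(1) dom] x by simp
  show ?thesis
    using that[OF xs(1)] dom[unfolded d] x[unfolded d] .
qed

lemma ancestor_verts:
  assumes "y \<preceq> x"
  shows "y \<in> verts T" "x \<in> verts T"
proof -
  show x: "x \<in> verts T" using assms by (simp add: ancestor_def)
  obtain p where p: "root_path T p" "depth T x \<in> path_dom p" "path_nth p (depth T x) = x"
    using obtain_path_to[OF x] .
  then obtain i where "i \<le> depth T x" "y = path_nth p i"
    using assms ancestor_path_nth[OF p(1,2), of y] by auto
  with p show "y \<in> verts T"
    using root_path_vertex(1)[OF p(1)] path_dom_downward[OF p(2)] by simp
qed

lemma ancestor_refl:
  assumes "x \<in> verts T"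
  shows "x \<preceq> x"
proof -
  obtain p where p: "root_path T p" "depth T x \<in> path_dom p" "path_nth p (depth T x) = x"
    using obtain_path_to[OF assms] .
  show ?thesis
    using ancestor_path_nth[OF p(1,2), of x] p(3) by auto
qed

lemma ancestor_trans:
  assumes "z \<preceq> y" "y \<preceq> x"
  shows "z \<preceq> x"
proof -
  obtain p where p: "root_path T p" "depth T x \<in> path_dom p" "path_nth p (depth T x) = x"
    using obtain_path_to[OF ancestor_verts(2)[OF assms(2)]] .
  note on_path = ancestor_path_nth[OF p(1) path_dom_downward[OF p(2)]]
  obtain i where i: "i \<le> depth T x" "y = path_nth p i"
    using assms(2) on_path[of "depth T x" y] p(3) by auto
  then obtain j where "j \<le> i" "z = path_nth p j"
    using assms(1) on_path[of i z] by auto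
  moreover from this i have "j \<le> depth T x" by simp
  ultimately show ?thesis
    using on_path[of "depth T x" z] p(3) by auto
qed

lemma ancestor_depth:
  assumes "y \<prec> x"
  shows "depth T y < depth T x"
proof -
  obtain p where p: "root_path T p" "depth T x \<in> path_dom p" "path_nth p (depth T x) = x"
    using obtain_path_to[OF ancestor_verts(2)[OF conjunct1[OF assms]]] .
  note on_path = ancestor_path_nth[OF p(1) path_dom_downward[OF p(2)]]
  obtain j where j: "j \<le> depth T x" "y = path_nth p j"
    using assms on_path[of "depth T x" y] p(3) by auto
  then have "j \<noteq> depth T x" using assms p(3) by auto
  with j root_path_vertex(2)[OF p(1) path_dom_downward[OF p(2) j(1)]] show ?thesis by simp
qed

lemma ancestor_antisym: "y \<preceq> x \<Longrightarrow> x \<preceq> y \<Longrightarrow> x = y"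
  using ancestor_depth[of x y] ancestor_depth[of y x] by fastforce

lemma ancestor_linear:
  assumes "y \<preceq> x" "z \<preceq> x"
  shows "y \<preceq> z \<or> z \<preceq> y"
proof -
  obtain p where p: "root_path T p" "depth T x \<in> path_dom p" "path_nth p (depth T x) = x"
    using obtain_path_to[OF ancestor_verts(2)[OF assms(1)]] .
  note on_path = ancestor_path_nth[OF p(1) path_dom_downward[OF p(2)]]
  obtain i where i: "i \<le> depth T x" "y = path_nth p i"
    using assms(1) on_path[of "depth T x" y] p(3) by auto
  obtain j where j: "j \<le> depth T x" "z = path_nth p j"
    using assms(2) on_path[of "depth T x" z] p(3) by auto
  show ?thesis
    using i j on_path[of i z] on_path[of j y] by (metis nat_le_linear)
qed

text \<open>Ancestor chains are finite, so a property met on the way to x is met for a first time;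
  all later arguments start from such a first vertex.\<close>

lemma obtain_first:
  assumes "x \<in> verts T" "P x"
  obtains y where "y \<preceq> x" "P y" "\<And>z. z \<prec> y \<Longrightarrow> \<not> P z"
proof -
  define y where "y = (ARG_MIN (depth T) y. y \<preceq> x \<and> P y)"
  have ex: "x \<preceq> x \<and> P x" using assms ancestor_refl by simp
  have y: "y \<preceq> x" "P y"
    using arg_min_natI[of "\<lambda>y. y \<preceq> x \<and> P y", OF ex] by (auto simp: y_def)
  have "\<not> P z" if z: "z \<prec> y" for z
  proof
    assume "P z"
    then have "depth T y \<le> depth T z"
      unfolding y_def using z y(1) ancestor_trans \<open>P z\<close> by (intro arg_min_nat_le) blast
    with ancestor_depth[OF z] show False by simp
  qed
  with y that show ?thesis by blast
qed


section \<open>The lexicographic difference in terms of ancestors\<close>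

text \<open>This is the strict lexicographic comparison of v and u along the path to x; the witness d is
  the first vertex where they differ. Keeping d explicit shows that the comparison, once
  decided, stays decided at all descendants.\<close>

definition lex_above :: "('v \<Rightarrow> int) \<Rightarrow> ('v \<Rightarrow> int) \<Rightarrow> 'v \<Rightarrow> bool" where
  "lex_above u v x \<longleftrightarrow> (\<exists>d. d \<preceq> x \<and> v d < u d \<and> (\<forall>y. y \<prec> d \<longrightarrow> u y = v y))"

lemma lex_aboveI:
  assumes "d \<preceq> x" "v d < u d" "\<And>y. y \<prec> d \<Longrightarrow> u y = v y"
  shows "lex_above u v x"
  using assms unfolding lex_above_def by blast

lemma lex_aboveE:
  assumes "lex_above u v x"
  obtains d where "d \<preceq> x" "v d < u d" "\<And>y. y \<prec> d \<Longrightarrow> u y = v y"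
  using assms unfolding lex_above_def by blast

lemma lex_above_mono: "lex_above u v x \<Longrightarrow> x \<preceq> z \<Longrightarrow> lex_above u v z"
  unfolding lex_above_def using ancestor_trans by blast

lemma lexordp_map_iff:
  fixes u v :: "'b \<Rightarrow> int"
  shows "ord_class.lexordp (map v xs) (map u xs) \<longleftrightarrow>
    (\<exists>i<length xs. v (xs ! i) < u (xs ! i) \<and> (\<forall>j<i. v (xs ! j) = u (xs ! j)))"
proof (induction xs)
  case Nil
  then show ?case by simp
next
  case (Cons x xs)
  have "(\<exists>i<length (x # xs). v ((x # xs) ! i) < u ((x # xs) ! i) \<and>
        (\<forall>j<i. v ((x # xs) ! j) = u ((x # xs) ! j))) \<longleftrightarrow>
      v x < u x \<or> v x = u x \<and>
        (\<exists>i<length xs. v (xs ! i) < u (xs ! i) \<and> (\<forall>j<i. v (xs ! j) = u (xs ! j)))"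
    by (simp add: Ex_less_Suc2 All_less_Suc2) blast
  with Cons.IH show ?case by auto
qed

lemma tree_diff_eq: "tree_diff T u v x = (if lex_above u v x then u x - v x else 0)"
proof (cases "x \<in> verts T")
  case False
  then have "\<not> lex_above u v x"
    by (auto simp: lex_above_def ancestor_def)
  with False show ?thesis by (simp add: tree_diff_def)
next
  case True
  obtain p where p: "root_path T p" "depth T x \<in> path_dom p" "path_nth p (depth T x) = x"
    using obtain_path_to[OF True] .
  let ?n = "depth T x" and ?f = "path_nth p"
  have path: "path_to T x = map ?f [0..<Suc ?n]"
    using path_to_path_nth[OF p(1,2)] p(3) by simp
  have "ord_class.lexordp (map v (path_to T x)) (map u (path_to T x)) \<longleftrightarrow>
      (\<exists>i<Suc ?n. v (?f i) < u (?f i) \<and> (\<forall>j<i. v (?f j) = u (?f j)))"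
    unfolding lexordp_map_iff path by (auto simp del: upt_Suc)
  also have "\<dots> \<longleftrightarrow> (\<exists>i\<le>?n. v (?f i) < u (?f i) \<and> (\<forall>y. y \<prec> ?f i \<longrightarrow> u y = v y))"
  proof -
    have "(\<forall>y. y \<prec> ?f i \<longrightarrow> u y = v y) \<longleftrightarrow> (\<forall>j<i. v (?f j) = u (?f j))" if "i \<le> ?n" for i
      unfolding proper_ancestor_path_nth[OF p(1) path_dom_downward[OF p(2) that]] by auto
    then show ?thesis by (simp add: less_Suc_eq_le cong: conj_cong)
  qed
  also have "\<dots> \<longleftrightarrow> lex_above u v x"
    unfolding lex_above_def ancestor_path_nth[OF p(1,2), unfolded p(3)] by auto
  finally show ?thesis
    using True by (simp add: tree_diff_def)
qed

lemma tree_carrier_iff: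
  "u \<in> tree_carrier T \<longleftrightarrow>
     (\<forall>x. x \<notin> verts T \<longrightarrow> u x = 0) \<and> finite {x. u x \<noteq> 0} \<and>
     (\<forall>x\<in>verts T. u x \<noteq> 0 \<and> (\<forall>y. y \<prec> x \<longrightarrow> u y = 0) \<longrightarrow> 0 < u x)"
proof -
  have "(\<forall>p\<in>root_paths T. \<forall>i\<in>path_dom p.
      u (path_nth p i) \<noteq> 0 \<and> (\<forall>j<i. u (path_nth p j) = 0) \<longrightarrow> u (path_nth p i) > 0) \<longleftrightarrow>
    (\<forall>x\<in>verts T. u x \<noteq> 0 \<and> (\<forall>y. y \<prec> x \<longrightarrow> u y = 0) \<longrightarrow> 0 < u x)" (is "?L \<longleftrightarrow> ?R")
  proof
    assume L: ?L
    show ?R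
    proof (intro ballI impI)
      fix x
      assume x: "x \<in> verts T" "u x \<noteq> 0 \<and> (\<forall>y. y \<prec> x \<longrightarrow> u y = 0)"
      obtain p where p: "root_path T p" "depth T x \<in> path_dom p" "path_nth p (depth T x) = x"
        using obtain_path_to[OF x(1)] .
      have "\<forall>j<depth T x. u (path_nth p j) = 0"
        using x(2) proper_ancestor_path_nth[OF p(1,2)] p(3) by metis
      with L p x(2) show "0 < u x" by (metis mem_Collect_eq root_paths_def)
    qed
  next
    assume R: ?R
    show ?L
    proof (intro ballI impI)
      fix p i
      assume p: "p \<in> root_paths T" "i \<in> path_dom p"
        and u: "u (path_nth p i) \<noteq> 0 \<and> (\<forall>j<i. u (path_nth p j) = 0)"
      have rp: "root_path T p" using p(1) by (simp add: root_paths_def)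
      have "\<forall>y. y \<prec> path_nth p i \<longrightarrow> u y = 0"
        using u unfolding proper_ancestor_path_nth[OF rp p(2)] by auto
      with R u root_path_vertex(1)[OF rp p(2)] show "0 < u (path_nth p i)" by blast
    qed
  qed
  then show ?thesis by (simp add: tree_carrier_def)
qed

lemma carrier_outside: "u \<in> tree_carrier T \<Longrightarrow> x \<notin> verts T \<Longrightarrow> u x = 0"
  by (simp add: tree_carrier_iff)

lemma carrier_first_pos:
  assumes "u \<in> tree_carrier T" "u x \<noteq> 0" "\<And>y. y \<prec> x \<Longrightarrow> u y = 0"
  shows "0 < u x"
  using assms unfolding tree_carrier_iff by blast

lemma zero_in_carrier: "(\<lambda>_. 0) \<in> tree_carrier T"
  by (simp add: tree_carrier_iff)

text \<open>The first non-zero entry of a difference on a path sits exactly where the two arguments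
  first differ, and there the first argument is the larger one.\<close>

lemma tree_diff_in_carrier:
  assumes "u \<in> tree_carrier T" "v \<in> tree_carrier T"
  shows "tree_diff T u v \<in> tree_carrier T"
  unfolding tree_carrier_iff
proof (intro conjI ballI allI impI)
  show "tree_diff T u v x = 0" if "x \<notin> verts T" for x
    using that by (simp add: tree_diff_def)
  have "{x. tree_diff T u v x \<noteq> 0} \<subseteq> {x. u x \<noteq> 0} \<union> {x. v x \<noteq> 0}"
    by (auto simp: tree_diff_eq split: if_splits)
  then show "finite {x. tree_diff T u v x \<noteq> 0}"
    using assms by (auto simp: tree_carrier_iff intro: finite_subset)
next
  fix x
  assume x: "tree_diff T u v x \<noteq> 0 \<and> (\<forall>y. y \<prec> x \<longrightarrow> tree_diff T u v y = 0)"
  then have "lex_above u v x" by (auto simp: tree_diff_eq split: if_splits)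
  then obtain d where d: "d \<preceq> x" "v d < u d" "\<And>y. y \<prec> d \<Longrightarrow> u y = v y"
    by (metis lex_aboveE)
  have "lex_above u v d"
    using d ancestor_refl[OF ancestor_verts(1)[OF d(1)]] by (metis lex_aboveI)
  then have pos: "0 < tree_diff T u v d"
    using d by (simp add: tree_diff_eq)
  with x d(1) have "d = x" by force
  with pos show "0 < tree_diff T u v x" by simp
qed

definition single :: "'v \<Rightarrow> int \<Rightarrow> 'v \<Rightarrow> int" where
  "single a k = (\<lambda>x. if x = a then k else 0)"

lemma single_in_carrier:
  assumes "a \<in> verts T" "0 \<le> k"
  shows "single a k \<in> tree_carrier T"
proof -
  have "{x. single a k x \<noteq> 0} \<subseteq> {a}" by (auto simp: single_def)
  then have "finite {x. single a k x \<noteq> 0}" by (rule finite_subset) simp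
  with assms show ?thesis by (auto simp: tree_carrier_iff single_def)
qed

section \<open>Branches and the prime ideals they define\<close>

text \<open>A branch is the vertex set of a root-based path, described by the tree order alone.\<close>

definition branch :: "'v set \<Rightarrow> bool" where
  "branch F \<longleftrightarrow> F \<noteq> {} \<and> F \<subseteq> verts T \<and>
     (\<forall>x\<in>F. \<forall>y. y \<preceq> x \<longrightarrow> y \<in> F) \<and> (\<forall>x\<in>F. \<forall>y\<in>F. x \<preceq> y \<or> y \<preceq> x)"

definition vanishing :: "'v set \<Rightarrow> ('v \<Rightarrow> int) set" where
  "vanishing F = {u \<in> tree_carrier T. \<forall>x\<in>F. u x = 0}"

lemma bck_ideal_tree_iff:
  "bck_ideal (tree_algebra T) I \<longleftrightarrow> I \<subseteq> tree_carrier T \<and> (\<lambda>_. 0) \<in> I \<and>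
     (\<forall>u\<in>tree_carrier T. \<forall>v\<in>tree_carrier T. tree_diff T u v \<in> I \<and> v \<in> I \<longrightarrow> u \<in> I)"
  by (simp add: bck_ideal_def tree_algebra_def)

lemma bck_prime_ideal_tree_iff:
  "bck_prime_ideal (tree_algebra T) P \<longleftrightarrow>
     bck_ideal (tree_algebra T) P \<and> P \<noteq> tree_carrier T \<and>
     (\<forall>u\<in>tree_carrier T. \<forall>v\<in>tree_carrier T.
        tree_diff T v (tree_diff T v u) \<in> P \<longrightarrow> u \<in> P \<or> v \<in> P)"
  by (simp add: bck_prime_ideal_def bck_meet_def) (simp add: tree_algebra_def)

lemma obtain_first_nonzero:
  assumes "branch F" "u \<in> tree_carrier T" "u \<notin> vanishing F"
  obtains a where "a \<in> F" "0 < u a" "\<And>y. y \<prec> a \<Longrightarrow> u y = 0"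
proof -
  obtain x where x: "x \<in> F" "u x \<noteq> 0"
    using assms(2,3) by (auto simp: vanishing_def)
  then have "x \<in> verts T" using assms(1) by (auto simp: branch_def)
  from obtain_first[of x "\<lambda>x. u x \<noteq> 0", OF this x(2)]
  obtain a where a: "a \<preceq> x" "u a \<noteq> 0" "\<And>y. y \<prec> a \<Longrightarrow> u y = 0" by auto
  have "a \<in> F" using assms(1) x(1) a(1) by (auto simp: branch_def)
  with that a carrier_first_pos[OF assms(2) a(2,3)] show ?thesis by blast
qed

lemma vanishing_ideal:
  assumes F: "branch F"
  shows "bck_ideal (tree_algebra T) (vanishing F)"
  unfolding bck_ideal_tree_iff
proof (intro conjI ballI impI)
  show "vanishing F \<subseteq> tree_carrier T" by (auto simp: vanishing_def)
  show "(\<lambda>_. 0) \<in> vanishing F" by (simp add: vanishing_def zero_in_carrier)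
next
  fix u v
  assume u: "u \<in> tree_carrier T" and v: "v \<in> tree_carrier T"
    and uv: "tree_diff T u v \<in> vanishing F \<and> v \<in> vanishing F"
  show "u \<in> vanishing F"
  proof (rule ccontr)
    assume "u \<notin> vanishing F"
    then obtain a where a: "a \<in> F" "0 < u a" "\<And>y. y \<prec> a \<Longrightarrow> u y = 0"
      using obtain_first_nonzero[OF F u] by blast
    have v0: "v x = 0" if "x \<preceq> a" for x
      using that uv F a(1) by (auto simp: vanishing_def branch_def)
    have aa: "a \<preceq> a" using F a(1) ancestor_refl by (auto simp: branch_def)
    then have "lex_above u v a"
      using a v0 by (intro lex_aboveI[of a]) auto
    then have "tree_diff T u v a \<noteq> 0"
      using a v0 aa by (simp add: tree_diff_eq)
    with uv a(1) show False by (simp add: vanishing_def)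
  qed
qed

text \<open>Let u and v first become non-zero on the branch at a and b. If v does not lexicographically
  exceed u at b, then v minus u is zero up to b and the meet agrees with v at b. Otherwise the two
  first differ at a or an ancestor of a, and the meet agrees with u at a.\<close>

lemma vanishing_prime:
  assumes F: "branch F"
  shows "bck_prime_ideal (tree_algebra T) (vanishing F)"
  unfolding bck_prime_ideal_tree_iff
proof (intro conjI ballI impI)
  show "bck_ideal (tree_algebra T) (vanishing F)" using vanishing_ideal[OF F] .
  obtain x where x: "x \<in> F" "x \<in> verts T" using F by (auto simp: branch_def)
  then have "single x 1 \<in> tree_carrier T" "single x 1 \<notin> vanishing F"
    using single_in_carrier[of x 1] by (auto simp: vanishing_def single_def)
  then show "vanishing F \<noteq> tree_carrier T" by blast
next
  fix u v
  assume u: "u \<in> tree_carrier T" and v: "v \<in> tree_carrier T"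
    and meet: "tree_diff T v (tree_diff T v u) \<in> vanishing F"
  show "u \<in> vanishing F \<or> v \<in> vanishing F"
  proof (rule ccontr)
    assume "\<not> ?thesis"
    then obtain a b where a: "a \<in> F" "0 < u a" "\<And>y. y \<prec> a \<Longrightarrow> u y = 0"
      and b: "b \<in> F" "0 < v b" "\<And>y. y \<prec> b \<Longrightarrow> v y = 0"
      using obtain_first_nonzero[OF F u] obtain_first_nonzero[OF F v] by metis
    define w where "w = tree_diff T v u"
    have F_self: "x \<preceq> x" if "x \<in> F" for x
      using that F ancestor_refl by (auto simp: branch_def)
    have meet0: "tree_diff T v w x = 0" if "x \<in> F" for x
      using that meet by (simp add: vanishing_def w_def)
    show False
    proof (cases "lex_above v u b")
      case False
      then have w0: "w x = 0" if "x \<preceq> b" for x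
        using that lex_above_mono by (auto simp: w_def tree_diff_eq)
      then have "lex_above v w b"
        using b F_self by (intro lex_aboveI[of b]) auto
      then have "tree_diff T v w b = v b"
        using w0 F_self[OF b(1)] by (simp add: tree_diff_eq)
      with meet0[OF b(1)] b(2) show False by simp
    next
      case True
      then obtain d where d: "d \<preceq> b" "u d < v d" "\<And>y. y \<prec> d \<Longrightarrow> v y = u y"
        by (metis lex_aboveE)
      have d_before: "v y = 0" "u y = 0" if "y \<prec> d" for y
      proof -
        have "y \<prec> b"
          using that d(1) ancestor_trans ancestor_antisym by blast
        then show "v y = 0" "u y = 0" using b(3)[of y] d(3)[of y] that by auto
      qed
      \<comment> \<open>Both elements vanish before d, so a cannot come earlier than d on the branch.\<close>
      have "d \<in> F" using F d(1) b(1) by (auto simp: branch_def)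
      then have "d \<preceq> a"
        using F a(1,2) d_before(2)[of a] F_self by (force simp: branch_def)
      have at_a: "w a = v a - u a"
        using lex_aboveI[of d a u v] \<open>d \<preceq> a\<close> d by (simp add: w_def tree_diff_eq)
      have before: "w y = v y" if y: "y \<prec> a" for y
      proof (cases "d \<preceq> y")
        case True
        then have "lex_above v u y" using d by (metis lex_aboveI)
        then show ?thesis using a(3)[OF y] by (simp add: w_def tree_diff_eq)
      next
        case False
        then have "y \<prec> d"
          using ancestor_linear[of y a d] y \<open>d \<preceq> a\<close> by auto
        then show ?thesis using d_before by (auto simp: w_def tree_diff_eq)
      qed
      have "lex_above v w a"
        using at_a before a F_self by (intro lex_aboveI[of a]) auto
      then have "tree_diff T v w a = u a"
        using at_a by (simp add: tree_diff_eq)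
      with meet0[OF a(1)] a(2) show False by simp
    qed
  qed
qed

text \<open>The indicator of a vertex outside G vanishes on G.\<close>

lemma branch_subset_if_vanishing_subset:
  assumes "F \<subseteq> verts T" "vanishing G \<subseteq> vanishing F"
  shows "F \<subseteq> G"
proof
  fix x
  assume x: "x \<in> F"
  then have "single x 1 \<in> tree_carrier T" using assms(1) single_in_carrier by auto
  moreover have "single x 1 \<notin> vanishing F" using x by (auto simp: vanishing_def single_def)
  ultimately have "\<exists>y\<in>G. single x 1 y \<noteq> 0" using assms(2) by (auto simp: vanishing_def)
  then show "x \<in> G" by (auto simp: single_def split: if_splits)
qed

section \<open>Every prime ideal comes from a branch\<close>

lemma ideal_cancel:
  assumes "bck_ideal (tree_algebra T) I" "u \<in> tree_carrier T" "tree_diff T u v \<in> I" "v \<in> I"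
  shows "u \<in> I"
  using assms unfolding bck_ideal_tree_iff by blast

lemma ideal_subset: "bck_ideal (tree_algebra T) I \<Longrightarrow> I \<subseteq> tree_carrier T"
  by (simp add: bck_ideal_tree_iff)

lemma ideal_zero: "bck_ideal (tree_algebra T) I \<Longrightarrow> (\<lambda>_. 0) \<in> I"
  by (simp add: bck_ideal_tree_iff)

lemma ideal_single:
  assumes "bck_ideal (tree_algebra T) I" "a \<in> verts T" "single a 1 \<in> I"
  shows "single a (int n) \<in> I"
proof (induction n)
  case 0
  have "single a (int 0) = (\<lambda>_. 0)" by (auto simp: single_def)
  with ideal_zero[OF assms(1)] show ?case by simp
next
  case (Suc n)
  have "lex_above (single a (int (Suc n))) (single a 1) a" if "0 < n"
    using that ancestor_refl[OF assms(2)]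
    by (intro lex_aboveI[of a]) (auto simp: single_def)
  then have "tree_diff T (single a (int (Suc n))) (single a 1) = single a (int n)"
    by (intro ext) (auto simp: tree_diff_eq single_def)
  with Suc.IH show ?case
    using ideal_cancel[OF assms(1) single_in_carrier[OF assms(2)] _ assms(3)] by auto
qed

text \<open>Let a be a vertex of the support none of whose proper ancestors is in the support. Subtracting
  a large multiple of the indicator of a erases u at a and at all descendants of a, and changes
  nothing else; so the support shrinks and induction applies.\<close>

lemma ideal_if_support_in_ideal:
  assumes I: "bck_ideal (tree_algebra T) I"
  assumes "u \<in> tree_carrier T" "\<And>a. u a \<noteq> 0 \<Longrightarrow> single a 1 \<in> I"
  shows "u \<in> I"
  using assms(2,3)
proof (induction "card {x. u x \<noteq> 0}" arbitrary: u rule: less_induct)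
  case less
  show ?case
  proof (cases "\<exists>x. u x \<noteq> 0")
    case False
    then have "u = (\<lambda>_. 0)" by auto
    with ideal_zero[OF I] show ?thesis by simp
  next
    case True
    then obtain x where x: "u x \<noteq> 0" by blast
    then have "x \<in> verts T" using carrier_outside[OF less.prems(1)] by blast
    from obtain_first[of x "\<lambda>x. u x \<noteq> 0", OF this x]
    obtain a where a: "a \<preceq> x" "u a \<noteq> 0" "\<And>y. y \<prec> a \<Longrightarrow> u y = 0" by auto
    note av = ancestor_verts(1)[OF a(1)]
    have pos: "0 < u a" using carrier_first_pos[OF less.prems(1) a(2,3)] .
    \<comment> \<open>The value u a + 1 rather than u a makes v win the comparison at a itself, so that the
      values of u below a are erased whatever they are.\<close>
    define v where "v = single a (int (nat (u a + 1)))"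
    define w where "w = tree_diff T u v"
    have v_in: "v \<in> I"
      unfolding v_def using ideal_single[OF I av less.prems(2)[OF a(2)]] .
    have va: "v a = u a + 1" and v0: "\<And>y. y \<noteq> a \<Longrightarrow> v y = 0"
      using pos by (auto simp: v_def single_def)
    have w_support: "w y \<noteq> 0 \<Longrightarrow> u y \<noteq> 0" for y
      using va v0[of y] by (cases "y = a") (auto simp: w_def tree_diff_eq a(2) split: if_splits)
    have "\<not> lex_above u v a"
    proof
      assume "lex_above u v a"
      then obtain d where d: "d \<preceq> a" "v d < u d" by (metis lex_aboveE)
      then show False using va v0[of d] a(3)[of d] by (cases "d = a") auto
    qed
    then have "w a = 0" by (simp add: w_def tree_diff_eq)
    with w_support a(2) have "{x. w x \<noteq> 0} \<subset> {x. u x \<noteq> 0}" by auto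
    moreover have "finite {x. u x \<noteq> 0}" using less.prems(1) by (simp add: tree_carrier_iff)
    ultimately have "card {x. w x \<noteq> 0} < card {x. u x \<noteq> 0}" by (rule psubset_card_mono[rotated])
    moreover have "w \<in> tree_carrier T"
      unfolding w_def using less.prems(1) v_in ideal_subset[OF I] by (intro tree_diff_in_carrier) auto
    ultimately have "w \<in> I"
      using less.hyps less.prems(2) w_support by blast
    then show ?thesis
      using ideal_cancel[OF I less.prems(1) _ v_in] by (simp add: w_def)
  qed
qed

text \<open>The indicator e of a need not lie below u: if u has value 1 at a, it may be negative at some
  descendants. But e minus u is non-zero only at proper descendants of a, and there u exceeds it
  because of the positive value at a; so subtracting u once more gives zero.\<close>

lemma ideal_single_first_nonzero:
  assumes I: "bck_ideal (tree_algebra T) I" and u: "u \<in> I"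
    and a: "0 < u a" "\<And>y. y \<prec> a \<Longrightarrow> u y = 0"
  shows "single a 1 \<in> I"
proof -
  have uc: "u \<in> tree_carrier T" using u ideal_subset[OF I] by blast
  have av: "a \<in> verts T" using carrier_outside[OF uc] a(1) by force
  define w where "w = tree_diff T (single a 1) u"
  have below: "a \<prec> x" if above: "lex_above (single a 1) u x" for x
  proof -
    obtain d where d: "d \<preceq> x" "u d < single a 1 d" "\<And>y. y \<prec> d \<Longrightarrow> single a 1 y = u y"
      using above by (metis lex_aboveE)
    have "d \<noteq> a" using d(2) a(1) by (auto simp: single_def)
    then have "u d < 0" using d(2) by (simp add: single_def)
    then obtain y where y: "y \<prec> d" "u y \<noteq> 0"
      using carrier_first_pos[OF uc, of d] by force
    then have "y = a" using d(3)[of y] by (auto simp: single_def split: if_splits)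
    then show ?thesis using y(1) d(1) ancestor_trans ancestor_antisym by blast
  qed
  have w0: "w x = 0" if "\<not> a \<prec> x" for x
    using below that by (auto simp: w_def tree_diff_eq)
  have "\<not> lex_above w u x" for x
  proof
    assume "lex_above w u x"
    then obtain d where d: "d \<preceq> x" "u d < w d" "\<And>y. y \<prec> d \<Longrightarrow> w y = u y"
      by (metis lex_aboveE)
    show False
    proof (cases "a \<prec> d")
      case True
      then show False using d(3)[of a] w0[of a] a(1) by simp
    next
      case False
      have "u y = 0" if "y \<prec> d" for y
      proof -
        have "\<not> a \<prec> y" using False that ancestor_trans ancestor_antisym by blast
        then show ?thesis using w0[of y] d(3)[of y] that by simp
      qed
      then show False
        using carrier_first_pos[OF uc, of d] d(2) w0[OF False] by force
    qed
  qed
  then have "tree_diff T w u = (\<lambda>_. 0)" by (auto simp: tree_diff_eq)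
  moreover have "w \<in> tree_carrier T"
    unfolding w_def using single_in_carrier[OF av] uc by (intro tree_diff_in_carrier) auto
  ultimately have "w \<in> I"
    using ideal_cancel[OF I _ _ u] ideal_zero[OF I] by simp
  then show ?thesis
    using ideal_cancel[OF I single_in_carrier[OF av] _ u] by (simp add: w_def)
qed

text \<open>The closure condition under ancestors is what transfers the conclusion at the first non-zero
  value of an element to a later vertex of the set.\<close>

lemma ideal_eq_vanishing:
  assumes I: "bck_ideal (tree_algebra T) I"
    and down: "\<And>x y. x \<in> verts T \<Longrightarrow> single x 1 \<notin> I \<Longrightarrow> y \<preceq> x \<Longrightarrow> single y 1 \<notin> I"
  shows "I = vanishing {x \<in> verts T. single x 1 \<notin> I}" (is "I = vanishing ?F")
proof
  show "vanishing ?F \<subseteq> I"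
    using ideal_if_support_in_ideal[OF I] carrier_outside by (auto simp: vanishing_def)
  show "I \<subseteq> vanishing ?F"
  proof
    fix u
    assume u: "u \<in> I"
    then have uc: "u \<in> tree_carrier T" using ideal_subset[OF I] by blast
    have "u x = 0" if x: "x \<in> ?F" for x
    proof (rule ccontr)
      assume "u x \<noteq> 0"
      from obtain_first[of x "\<lambda>x. u x \<noteq> 0", OF _ this] x
      obtain a where a: "a \<preceq> x" "u a \<noteq> 0" "\<And>y. y \<prec> a \<Longrightarrow> u y = 0" by auto
      have "single a 1 \<in> I"
        using ideal_single_first_nonzero[OF I u carrier_first_pos[OF uc a(2,3)] a(3)] .
      with down a(1) x show False by auto
    qed
    with uc show "u \<in> vanishing ?F" by (simp add: vanishing_def)
  qed
qed

lemma tree_diff_single_ancestor: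
  assumes "b \<prec> a"
  shows "tree_diff T (single a 1) (single b 1) = (\<lambda>_. 0)"
proof -
  have "\<not> lex_above (single a 1) (single b 1) x" for x
  proof
    assume "lex_above (single a 1) (single b 1) x"
    then obtain d where d: "single b 1 d < single a 1 d"
        "\<And>y. y \<prec> d \<Longrightarrow> single a 1 y = single b 1 y"
      by (metis lex_aboveE)
    then have "d = a" by (auto simp: single_def split: if_splits)
    then show False using d(2)[of b] assms by (simp add: single_def)
  qed
  then show ?thesis by (auto simp: tree_diff_eq)
qed

lemma tree_diff_single_incomparable:
  assumes "a \<in> verts T" "b \<in> verts T" "\<not> a \<preceq> b" "\<not> b \<preceq> a"
  shows "tree_diff T (single b 1) (single a 1) = single b 1"
proof
  fix x
  have ne: "a \<noteq> b" using assms ancestor_refl by blast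
  have at_b: "lex_above (single b 1) (single a 1) b"
    using ne assms(3) ancestor_refl[OF assms(2)]
    by (intro lex_aboveI[of b]) (auto simp: single_def)
  have at_a: "\<not> lex_above (single b 1) (single a 1) a"
  proof
    assume "lex_above (single b 1) (single a 1) a"
    then obtain d where "d \<preceq> a" "single a 1 d < single b 1 d"
      by (metis lex_aboveE)
    then show False using assms(4) by (auto simp: single_def split: if_splits)
  qed
  show "tree_diff T (single b 1) (single a 1) x = single b 1 x"
    using at_a at_b ne by (auto simp: tree_diff_eq single_def)
qed

lemma prime_ideal_obtain_branch:
  assumes P: "bck_prime_ideal (tree_algebra T) P"
  obtains F where "branch F" "P = vanishing F"
proof -
  define F where "F = {x \<in> verts T. single x 1 \<notin> P}"
  have I: "bck_ideal (tree_algebra T) P" and proper: "P \<noteq> tree_carrier T"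
    and prime: "\<And>u v. u \<in> tree_carrier T \<Longrightarrow> v \<in> tree_carrier T \<Longrightarrow>
      tree_diff T v (tree_diff T v u) \<in> P \<Longrightarrow> u \<in> P \<or> v \<in> P"
    using P unfolding bck_prime_ideal_tree_iff by blast+
  have down: "single y 1 \<notin> P" if "x \<in> verts T" "single x 1 \<notin> P" "y \<preceq> x" for x y
  proof (cases "y = x")
    case False
    then have "tree_diff T (single x 1) (single y 1) \<in> P"
      using tree_diff_single_ancestor[of y x] that(3) ideal_zero[OF I] by simp
    then show ?thesis
      using ideal_cancel[OF I single_in_carrier[OF that(1)]] that(2) by auto
  qed (use that in simp)
  have eq: "P = vanishing F"
    unfolding F_def using ideal_eq_vanishing[OF I down] .
  have "branch F"
    unfolding branch_def
  proof (intro conjI ballI allI impI)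
    show "F \<noteq> {}" using eq proper by (auto simp: vanishing_def)
    show "F \<subseteq> verts T" by (auto simp: F_def)
    show "y \<in> F" if "x \<in> F" "y \<preceq> x" for x y
      using that down ancestor_verts(1) by (auto simp: F_def)
    show "x \<preceq> y \<or> y \<preceq> x" if x: "x \<in> F" and y: "y \<in> F" for x y
    proof (rule ccontr)
      assume "\<not> ?thesis"
      then have "tree_diff T (single y 1) (single x 1) = single y 1"
        using x y by (intro tree_diff_single_incomparable) (auto simp: F_def)
      moreover have "tree_diff T (single y 1) (single y 1) = (\<lambda>_. 0)"
        by (auto simp: tree_diff_eq)
      ultimately have "single x 1 \<in> P \<or> single y 1 \<in> P"
        using x y ideal_zero[OF I] by (intro prime single_in_carrier) (auto simp: F_def)
      then show False using x y by (simp add: F_def)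
    qed
  qed
  with eq that show ?thesis by blast
qed

section \<open>Branches and root-based paths\<close>

definition path_verts :: "'v path \<Rightarrow> 'v set" where
  "path_verts p = path_nth p ` path_dom p"

lemma path_verts_branch:
  assumes p: "root_path T p"
  shows "branch (path_verts p)"
  unfolding branch_def
proof (intro conjI ballI allI impI)
  show "path_verts p \<noteq> {}" using p by (auto simp: path_verts_def root_path_def)
  show "path_verts p \<subseteq> verts T" using root_path_vertex(1)[OF p] by (auto simp: path_verts_def)
  show "y \<in> path_verts p" if x: "x \<in> path_verts p" and y: "y \<preceq> x" for x y
  proof -
    obtain j where j: "j \<in> path_dom p" "x = path_nth p j"
      using x by (auto simp: path_verts_def)
    then obtain i where "i \<le> j" "y = path_nth p i"
      using y ancestor_path_nth[OF p j(1), of y] by auto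
    then show ?thesis using path_dom_downward[OF j(1)] by (auto simp: path_verts_def)
  qed
  show "x \<preceq> y \<or> y \<preceq> x" if x: "x \<in> path_verts p" and y: "y \<in> path_verts p" for x y
  proof -
    obtain i j where ij: "i \<in> path_dom p" "x = path_nth p i" "j \<in> path_dom p" "y = path_nth p j"
      using x y by (auto simp: path_verts_def)
    then show ?thesis
      using ancestor_path_nth[OF p ij(1), of y] ancestor_path_nth[OF p ij(3), of x]
      by (metis nat_le_linear)
  qed
qed

text \<open>The set of vertices remembers the order of the path, since the position of a vertex is its
  depth.\<close>

lemma path_prefix_iff_path_verts:
  assumes p: "root_path T p" and q: "root_path T q"
  shows "path_prefix p q \<longleftrightarrow> path_verts p \<subseteq> path_verts q"
proof
  assume "path_prefix p q"
  then show "path_verts p \<subseteq> path_verts q"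
    by (force simp: path_prefix_def path_verts_def)
next
  assume sub: "path_verts p \<subseteq> path_verts q"
  have "i \<in> path_dom q \<and> path_nth p i = path_nth q i" if i: "i \<in> path_dom p" for i
  proof -
    obtain j where j: "j \<in> path_dom q" "path_nth p i = path_nth q j"
      using sub i by (auto simp: path_verts_def)
    then have "i = j"
      using root_path_vertex(2)[OF p i] root_path_vertex(2)[OF q j(1)] by simp
    with j show ?thesis by simp
  qed
  then show "path_prefix p q" by (auto simp: path_prefix_def)
qed

text \<open>A branch has at most one vertex of each depth, and the depths that occur form an initial
  segment of the natural numbers: listing its vertices by depth gives the path.\<close>

lemma branch_obtain_path:
  assumes F: "branch F"
  obtains p where "root_path T p" "path_verts p = F"
proof -
  define D where "D = depth T ` F"
  define f where "f = inv_into F (depth T)"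
  have FV: "F \<subseteq> verts T" and Fne: "F \<noteq> {}"
    and Fdown: "\<And>x y. x \<in> F \<Longrightarrow> y \<preceq> x \<Longrightarrow> y \<in> F"
    using F by (auto simp: branch_def)
  have inj: "inj_on (depth T) F"
  proof (rule inj_onI)
    fix x y
    assume "x \<in> F" "y \<in> F" "depth T x = depth T y"
    moreover from this have "x \<preceq> y \<or> y \<preceq> x" using F by (auto simp: branch_def)
    ultimately show "x = y" using ancestor_depth[of x y] ancestor_depth[of y x] by fastforce
  qed
  have f_depth: "f (depth T x) = x" if "x \<in> F" for x
    using that inj by (simp add: f_def)
  have parent: "\<exists>y\<in>F. depth T y = i \<and> away_step T y x" if x: "x \<in> F" "depth T x = Suc i" for x i
  proof -
    obtain p where p: "root_path T p" "depth T x \<in> path_dom p" "path_nth p (depth T x) = x"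
      using obtain_path_to x(1) FV by blast
    have i: "i \<in> path_dom p" using path_dom_downward[OF p(2)] x(2) by simp
    have "path_nth p i \<preceq> x"
      using ancestor_path_nth[OF p(1,2)] p(3) x(2) by (metis le_SucI order_refl)
    moreover have "away_step T (path_nth p i) x"
      using p x(2) by (auto simp: root_path_def)
    ultimately show ?thesis
      using Fdown[OF x(1)] root_path_vertex(2)[OF p(1) i] by blast
  qed
  have Suc_D: "i \<in> D \<and> away_step T (f i) (f (Suc i))" if i: "Suc i \<in> D" for i
  proof -
    obtain x where x: "Suc i = depth T x" "x \<in> F"
      using i unfolding D_def by (rule imageE)
    obtain y where y: "y \<in> F" "depth T y = i" "away_step T y x" using parent[OF x(2) x(1)[symmetric]] by blast
    have "f (Suc i) = x" "f i = y"
      using f_depth[OF x(2)] f_depth[OF y(1)] unfolding x(1)[symmetric] y(2) .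
    moreover have "i \<in> D" unfolding D_def using y(1,2) by auto
    ultimately show ?thesis using y(3) by simp
  qed
  have D_down: "i \<in> D" if "j \<in> D" "i \<le> j" for i j
    using that(2)
  proof (induction rule: inc_induct)
    case base
    show ?case using that(1) .
  next
    case (step n)
    show ?case using Suc_D[OF step.IH] by (rule conjunct1)
  qed
  have "D \<noteq> {}" using Fne by (simp add: D_def)
  then have zero_D: "0 \<in> D" using D_down by blast
  then obtain r where r: "0 = depth T r" "r \<in> F"
    unfolding D_def by (rule imageE)
  then have f0: "f 0 = root T"
    using f_depth[OF r(2)] depth_eq_0[of r] FV by auto
  obtain p where p: "path_dom p = D" "\<And>i. i \<in> D \<Longrightarrow> path_nth p i = f i"
  proof (cases "D = UNIV")
    case True
    then show ?thesis by (intro that[of "Inf f"]) auto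
  next
    case False
    define m where "m = (LEAST i. i \<notin> D)"
    have m: "m \<notin> D" unfolding m_def using False by (metis LeastI UNIV_eq_I)
    have "i \<in> D \<longleftrightarrow> i < m" for i
    proof
      show "i < m" if "i \<in> D" using that m D_down[OF that, of m] not_less by blast
      show "i \<in> D" if "i < m"
        using not_less_Least[of i "\<lambda>i. i \<notin> D"] that by (simp add: m_def)
    qed
    then have "D = {..<m}" by auto
    then show ?thesis by (intro that[of "Fin (map f [0..<m])"]) auto
  qed
  have "root_path T p"
    unfolding root_path_def p(1)
  proof (intro conjI allI impI)
    show "0 \<in> D" using zero_D .
    show "path_nth p 0 = root T" using p(2)[OF zero_D] f0 by simp
    show "away_step T (path_nth p i) (path_nth p (Suc i))" if "Suc i \<in> D" for i
      using Suc_D[OF that] p(2)[OF that] p(2)[of i] by simp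
  qed
  moreover have "path_verts p = F"
  proof -
    have "path_verts p = f ` D" using p by (auto simp: path_verts_def)
    also have "\<dots> = F" using f_depth by (simp add: D_def image_image)
    finally show ?thesis .
  qed
  ultimately show ?thesis using that by blast
qed

end

text \<open>The domain tells a finite path from an infinite one.\<close>

lemma path_eqI:
  assumes "path_dom p = path_dom q" "\<And>i. i \<in> path_dom p \<Longrightarrow> path_nth p i = path_nth q i"
  shows "p = q"
proof -
  have "{..<n} \<noteq> (UNIV :: nat set)" for n by (metis finite_lessThan infinite_UNIV_nat)
  then show ?thesis
    using assms by (cases p; cases q) (auto intro: nth_equalityI)
qed

text \<open>A surjection that preserves and reflects the orders is injective by antisymmetry. The map is
  given from B to A, as a path determines its ideal explicitly; its inverse is the isomorphism.\<close>

lemma posets_isomorphic_relation_ofI: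
  assumes "partial_order_on A (relation_of R A)" "partial_order_on B ((relation_of S B)\<inverse>)"
    and g: "g ` B = A" "\<And>p q. p \<in> B \<Longrightarrow> q \<in> B \<Longrightarrow> S p q \<longleftrightarrow> R (g q) (g p)"
  shows "posets_isomorphic A (relation_of R A) B ((relation_of S B)\<inverse>)"
proof -
  have "inj_on g B"
  proof (rule inj_onI)
    fix p q
    assume pq: "p \<in> B" "q \<in> B" "g p = g q"
    have "R (g p) (g p)"
      using assms(1) g(1) pq(1)
      by (auto simp: partial_order_on_def preorder_on_def refl_on_def relation_of_def)
    then have "S p q" "S q p" using g(2) pq by auto
    then show "p = q"
      using assms(2) pq(1,2) by (auto simp: partial_order_on_def antisym_def relation_of_def)
  qed
  then have bij: "bij_betw g B A" using g(1) by (simp add: bij_betw_def)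
  let ?f = "the_inv_into B g"
  have "(x, y) \<in> relation_of R A \<longleftrightarrow> (?f x, ?f y) \<in> (relation_of S B)\<inverse>"
    if "x \<in> A" "y \<in> A" for x y
    using that g bij_betwE[OF bij_betw_the_inv_into[OF bij]] f_the_inv_into_f_bij_betw[OF bij]
    by (auto simp: relation_of_def)
  then show ?thesis
    unfolding posets_isomorphic_def
    using assms(1,2) bij_betw_the_inv_into[OF bij] by blast
qed

theorem proposition3p12:
  fixes T :: "'v rooted_graph"
  assumes "rooted_tree T"
  shows "posets_isomorphic
           (bck_spectrum (tree_algebra T))
           (relation_of (\<subseteq>) (bck_spectrum (tree_algebra T)))
           (root_paths T)
           ((relation_of path_prefix (root_paths T))\<inverse>)"
proof -
  interpret tree T using assms by unfold_locales
  define g where "g p = vanishing (path_verts p)" for p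
  show ?thesis
  proof (rule posets_isomorphic_relation_ofI)
    show "partial_order_on (bck_spectrum (tree_algebra T))
        (relation_of (\<subseteq>) (bck_spectrum (tree_algebra T)))"
      by (rule partial_order_on_relation_ofI) auto
    have "partial_order_on (root_paths T) (relation_of path_prefix (root_paths T))"
    proof (rule partial_order_on_relation_ofI)
      show "path_prefix p p" for p :: "'v path" by (simp add: path_prefix_def)
      show "path_prefix p r" if "path_prefix p q" "path_prefix q r" for p q r :: "'v path"
        using that by (auto simp: path_prefix_def)
      show "p = q" if "path_prefix p q" "path_prefix q p" for p q :: "'v path"
        using that by (intro path_eqI) (auto simp: path_prefix_def)
    qed
    then show "partial_order_on (root_paths T) ((relation_of path_prefix (root_paths T))\<inverse>)"
      by simp
    show "g ` root_paths T = bck_spectrum (tree_algebra T)"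
    proof
      show "g ` root_paths T \<subseteq> bck_spectrum (tree_algebra T)"
        using vanishing_prime path_verts_branch
        by (auto simp: g_def root_paths_def bck_spectrum_def)
      show "bck_spectrum (tree_algebra T) \<subseteq> g ` root_paths T"
      proof
        fix P
        assume "P \<in> bck_spectrum (tree_algebra T)"
        then obtain F where F: "branch F" "P = vanishing F"
          using prime_ideal_obtain_branch by (auto simp: bck_spectrum_def)
        obtain p where "root_path T p" "path_verts p = F"
          using branch_obtain_path[OF F(1)] .
        with F(2) show "P \<in> g ` root_paths T" by (auto simp: g_def root_paths_def)
      qed
    qed
  next
    fix p q
    assume "p \<in> root_paths T" "q \<in> root_paths T"
    then have pq: "root_path T p" "root_path T q" by (simp_all add: root_paths_def)
    have "path_verts p \<subseteq> path_verts q \<longleftrightarrow> g q \<subseteq> g p"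
    proof
      show "g q \<subseteq> g p" if "path_verts p \<subseteq> path_verts q"
        using that by (auto simp: g_def vanishing_def)
      show "path_verts p \<subseteq> path_verts q" if "g q \<subseteq> g p"
        using branch_subset_if_vanishing_subset that path_verts_branch[OF pq(1)]
        by (auto simp: g_def branch_def)
    qed
    with path_prefix_iff_path_verts[OF pq] show "path_prefix p q \<longleftrightarrow> g q \<subseteq> g p" by simp
  qed
qed

end
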